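(* Let $\nu>0$, $\lambda>0$, $\alpha>0$. Let $f\in C(\mathbb R,\ell_2)$ be translation-compact (i.e. $\{f^h : h\in\mathbb R\}$ is precompact in $C(\mathbb R,\ell_2)$), and let $F\in C(\mathbb R,\mathbb R)$ be Lipschitz continuous on bounded sets with $F(0)=0$ and $sF(s)\le -\alpha s^2$ for all $s\in\mathbb R$. For $g\in H(f)$ consider the equation $$u'=\nu\Lambda u-\lambda u+\widetilde F(u)+g(t)\qquad ( * )_g$$ in $\ell_2$. Then: (1) for every $(v,g)\in\ell_2\times H(f)$ there exists a unique solution $\varphi(t,v,g)$ of $( * )_g$ passing through the point $v$ at the initial moment $t=0$ and defined on $\mathbb R_+:=[0,+\infty)$; (2) $\varphi(0,v,g)=v$ for all $(v,g)\in\ell_2\times H(f)$; (3) $\varphi(t+\tau,v,g)=\varphi(t,\varphi(\tau,v,g),g^\tau)$ for all $t,\tau\in\mathbb R_+$, $v\in\ell_2$ and $g\in H(f)$; (4) the mapping $\varphi:\mathbb R_+\times\ell_2\times H(f)\to\ell_2$, $(t,v,g)\mapsto\varphi(t,v,g)$, is continuous.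
   Context: $\ell_2$ is the Hilbert space of real two-sided square-summable sequences $u=(u_i)_{i\in\mathbb Z}$ with norm $\|\cdot\|$. $(\Lambda u)_i:=u_{i-1}-2u_i+u_{i+1}$ (a bounded linear operator on $\ell_2$) and $\widetilde F(u)_i:=F(u_i)$ (which maps $\ell_2$ to $\ell_2$ when $F(0)=0$ and $F$ is Lipschitz on bounded sets). $C(\mathbb R,\ell_2)$ is the space of continuous functions $\mathbb R\to\ell_2$ with the compact-open topology (uniform convergence on compact intervals), metrized by $d(f_1,f_2)=\sup_{L>0}\min\{\max_{|t|\le L}\|f_1(t)-f_2(t)\|,L^{-1}\}$. $f^h(t):=f(t+h)$; $H(f)$ is the closure of $\{f^h: h\in\mathbb R\}$ in $C(\mathbb R,\ell_2)$, with the induced topology. *)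

theory Defs
  imports "HOL-Analysis.Analysis"
begin

section \<open>The Hilbert space of real two-sided square-summable sequences\<close>

typedef ell2 = "{u :: int \<Rightarrow> real. (\<lambda>i. (u i)\<^sup>2) summable_on UNIV}"
  morphisms nth_ell2 Abs_ell2
  by (rule exI[of _ "\<lambda>_. 0"]) simp

setup_lifting type_definition_ell2

lemma square_summable: "(\<lambda>i. (nth_ell2 u i)\<^sup>2) summable_on UNIV"
  using nth_ell2[of u] by simp

lemma square_summable_add:
  fixes u v :: "int \<Rightarrow> real"
  assumes "(\<lambda>i. (u i)\<^sup>2) summable_on UNIV" "(\<lambda>i. (v i)\<^sup>2) summable_on UNIV"
  shows "(\<lambda>i. (u i + v i)\<^sup>2) summable_on UNIV"
proof (rule summable_on_comparison_test)
  show "(\<lambda>i. 2 * ((u i)\<^sup>2 + (v i)\<^sup>2)) summable_on UNIV"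
    by (intro summable_on_cmult_right summable_on_add assms)
  show "(u i + v i)\<^sup>2 \<le> 2 * ((u i)\<^sup>2 + (v i)\<^sup>2)" for i
    using sum_squares_ge_zero[of "u i - v i" 0] by (simp add: power2_eq_square algebra_simps)
qed auto

lemma square_summable_cmult:
  fixes u :: "int \<Rightarrow> real"
  assumes "(\<lambda>i. (u i)\<^sup>2) summable_on UNIV"
  shows "(\<lambda>i. (c * u i)\<^sup>2) summable_on UNIV"
  using summable_on_cmult_right[OF assms, of "c\<^sup>2"] by (simp add: power_mult_distrib)

lemma square_summable_shift:
  fixes u :: "int \<Rightarrow> real"
  assumes "(\<lambda>i. (u i)\<^sup>2) summable_on UNIV"
  shows "(\<lambda>i. (u (i + k))\<^sup>2) summable_on UNIV"
proof -
  have "bij_betw (\<lambda>i. i + k) UNIV (UNIV :: int set)"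
    by (rule bij_betwI[where g = "\<lambda>i. i - k"]) auto
  from summable_on_reindex_bij_betw[OF this, of "\<lambda>i. (u i)\<^sup>2"] assms show ?thesis by simp
qed

lemma nth_prod_summable: "(\<lambda>i. nth_ell2 u i * nth_ell2 v i) summable_on UNIV"
proof -
  have "(\<lambda>i. (1/4) * ((nth_ell2 u i + nth_ell2 v i)\<^sup>2 + - ((nth_ell2 u i + (-1) * nth_ell2 v i)\<^sup>2)))
      summable_on UNIV"
    by (intro summable_on_cmult_right summable_on_add summable_on_uminus[THEN iffD2] square_summable_add
        square_summable square_summable_cmult)
  then show ?thesis
    by (rule summable_on_cong[THEN iffD1, rotated]) (simp add: power2_eq_square algebra_simps)
qed

instantiation ell2 :: real_vector
begin

lift_definition zero_ell2 :: ell2 is "\<lambda>_. 0" by simp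

lift_definition plus_ell2 :: "ell2 \<Rightarrow> ell2 \<Rightarrow> ell2" is "\<lambda>u v i. u i + v i"
  by (rule square_summable_add)

lift_definition uminus_ell2 :: "ell2 \<Rightarrow> ell2" is "\<lambda>u i. - u i" by simp

lift_definition minus_ell2 :: "ell2 \<Rightarrow> ell2 \<Rightarrow> ell2" is "\<lambda>u v i. u i - v i"
  subgoal for u v using square_summable_add[of u "\<lambda>i. - v i"] by simp
  done

lift_definition scaleR_ell2 :: "real \<Rightarrow> ell2 \<Rightarrow> ell2" is "\<lambda>c u i. c * u i"
  by (rule square_summable_cmult)

instance
  by standard (transfer; simp add: fun_eq_iff algebra_simps)+

end

instantiation ell2 :: real_inner
begin

definition inner_ell2 :: "ell2 \<Rightarrow> ell2 \<Rightarrow> real"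
  where "inner_ell2 u v = (\<Sum>\<^sub>\<infinity>i. nth_ell2 u i * nth_ell2 v i)"

definition norm_ell2 :: "ell2 \<Rightarrow> real"
  where "norm_ell2 u = sqrt (\<Sum>\<^sub>\<infinity>i. (nth_ell2 u i)\<^sup>2)"

definition sgn_ell2 :: "ell2 \<Rightarrow> ell2"
  where "sgn_ell2 u = inverse (norm u) *\<^sub>R u"

definition dist_ell2 :: "ell2 \<Rightarrow> ell2 \<Rightarrow> real"
  where "dist_ell2 u v = norm (u - v)"

definition uniformity_ell2 :: "(ell2 \<times> ell2) filter"
  where "uniformity_ell2 = (INF e\<in>{0<..}. principal {(u, v). dist u v < e})"

definition open_ell2 :: "ell2 set \<Rightarrow> bool"
  where "open_ell2 U \<longleftrightarrow> (\<forall>x\<in>U. \<forall>\<^sub>F (x', y) in uniformity. x' = x \<longrightarrow> y \<in> U)"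

instance
proof
  fix u v w :: ell2 and r :: real
  show "dist u v = norm (u - v)" by (rule dist_ell2_def)
  show "sgn u = u /\<^sub>R norm u" by (rule sgn_ell2_def)
  show "uniformity = (INF e\<in>{0<..}. principal {(u :: ell2, v). dist u v < e})"
    by (rule uniformity_ell2_def)
  show "open U \<longleftrightarrow> (\<forall>x\<in>U. \<forall>\<^sub>F (x', y) in uniformity. x' = x \<longrightarrow> y \<in> U)" for U :: "ell2 set"
    by (rule open_ell2_def)
  show "inner u v = inner v u" by (simp add: inner_ell2_def mult.commute)
  show "inner (u + v) w = inner u w + inner v w"
    by (simp add: inner_ell2_def plus_ell2.rep_eq distrib_right infsum_add nth_prod_summable)
  show "inner (r *\<^sub>R u) v = r * inner u v"
    by (simp add: inner_ell2_def scaleR_ell2.rep_eq mult.assoc infsum_cmult_right')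
  show "0 \<le> inner u u" by (simp add: inner_ell2_def infsum_nonneg)
  show "inner u u = 0 \<longleftrightarrow> u = 0"
  proof
    assume 0: "inner u u = 0"
    have "nth_ell2 u i * nth_ell2 u i = 0" for i
      by (rule nonneg_infsum_le_0D[where A = UNIV])
        (use 0 in \<open>auto simp: inner_ell2_def nth_prod_summable\<close>)
    then show "u = 0" by (simp add: nth_ell2_inject[symmetric] zero_ell2.rep_eq fun_eq_iff)
  qed (simp add: inner_ell2_def zero_ell2.rep_eq)
  show "norm u = sqrt (inner u u)"
    by (simp add: norm_ell2_def inner_ell2_def power2_eq_square)
qed

end

lemma norm_ell2_square: "(norm u)\<^sup>2 = (\<Sum>\<^sub>\<infinity>i. (nth_ell2 u i)\<^sup>2)"
  by (simp add: norm_ell2_def infsum_nonneg)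

lemma sum_square_le_norm_ell2:
  assumes "finite S" shows "(\<Sum>i\<in>S. (nth_ell2 u i)\<^sup>2) \<le> (norm u)\<^sup>2"
  unfolding norm_ell2_square by (rule finite_sum_le_infsum) (use assms square_summable in auto)

lemma abs_nth_le_norm_ell2: "\<bar>nth_ell2 u i\<bar> \<le> norm u"
  using sum_square_le_norm_ell2[of "{i}" u] by (simp add: abs_le_square_iff[symmetric])

instance ell2 :: complete_space
proof
  fix X :: "nat \<Rightarrow> ell2"
  assume X: "Cauchy X"
  have "Cauchy (\<lambda>n. nth_ell2 (X n) i)" for i
  proof (rule metric_CauchyI)
    fix e :: real assume "0 < e"
    with X obtain M where M: "\<And>m n. m \<ge> M \<Longrightarrow> n \<ge> M \<Longrightarrow> dist (X m) (X n) < e"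
      by (meson metric_CauchyD)
    have "dist (nth_ell2 (X m) i) (nth_ell2 (X n) i) \<le> dist (X m) (X n)" for m n
      using abs_nth_le_norm_ell2[of "X m - X n" i]
      by (simp add: dist_norm minus_ell2.rep_eq)
    with M show "\<exists>M. \<forall>m\<ge>M. \<forall>n\<ge>M. dist (nth_ell2 (X m) i) (nth_ell2 (X n) i) < e"
      by (meson le_less_trans)
  qed
  then have "\<forall>i. \<exists>l. (\<lambda>n. nth_ell2 (X n) i) \<longlonglongrightarrow> l"
    using convergent_def real_Cauchy_convergent by blast
  then obtain x where x: "\<And>i. (\<lambda>n. nth_ell2 (X n) i) \<longlonglongrightarrow> x i" by metis
  have bound: "(\<Sum>i\<in>S. (nth_ell2 (X n) i - x i)\<^sup>2) \<le> e\<^sup>2"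
    if "finite S" and M: "\<And>m n. m \<ge> M \<Longrightarrow> n \<ge> M \<Longrightarrow> dist (X m) (X n) < e" and "n \<ge> M"
    for S n M and e :: real
  proof (rule tendsto_upperbound)
    show "(\<lambda>m. \<Sum>i\<in>S. (nth_ell2 (X n) i - nth_ell2 (X m) i)\<^sup>2)
        \<longlonglongrightarrow> (\<Sum>i\<in>S. (nth_ell2 (X n) i - x i)\<^sup>2)"
      by (intro tendsto_sum tendsto_power tendsto_diff tendsto_const x)
    have "(\<Sum>i\<in>S. (nth_ell2 (X n) i - nth_ell2 (X m) i)\<^sup>2) \<le> e\<^sup>2" if "m \<ge> M" for m
    proof -
      have "(norm (X n - X m))\<^sup>2 \<le> e\<^sup>2"
        using M[OF \<open>n \<ge> M\<close> that] by (intro power_mono) (auto simp: dist_norm)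
      with sum_square_le_norm_ell2[OF \<open>finite S\<close>, of "X n - X m"] show ?thesis
        by (simp add: minus_ell2.rep_eq)
    qed
    then show "\<forall>\<^sub>F m in sequentially. (\<Sum>i\<in>S. (nth_ell2 (X n) i - nth_ell2 (X m) i)\<^sup>2) \<le> e\<^sup>2"
      unfolding eventually_sequentially by blast
  qed simp
  have diff: "(\<lambda>i. (nth_ell2 (X n) i - x i)\<^sup>2) summable_on UNIV"
    if M: "\<And>m n. m \<ge> M \<Longrightarrow> n \<ge> M \<Longrightarrow> dist (X m) (X n) < e" and "n \<ge> M"
    for n M and e :: real
    by (rule nonneg_bdd_above_summable_on)
      (use bound[OF _ M \<open>n \<ge> M\<close>] in \<open>auto intro!: bdd_aboveI2[where M = "e\<^sup>2"]\<close>)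
  obtain M1 where M1: "\<And>m n. m \<ge> M1 \<Longrightarrow> n \<ge> M1 \<Longrightarrow> dist (X m) (X n) < 1"
    using X by (meson metric_CauchyD zero_less_one)
  have "(\<lambda>i. (- (nth_ell2 (X M1) i - x i))\<^sup>2) summable_on UNIV"
    unfolding power2_minus by (rule diff[OF M1]) auto
  from square_summable_add[OF square_summable[of "X M1"] this]
  have "(\<lambda>i. (x i)\<^sup>2) summable_on UNIV" by simp
  then obtain y where y: "nth_ell2 y = x" using Abs_ell2_inverse by blast
  have "X \<longlonglongrightarrow> y"
  proof (rule metric_LIMSEQ_I)
    fix r :: real assume "0 < r"
    with X obtain M where M: "\<And>m n. m \<ge> M \<Longrightarrow> n \<ge> M \<Longrightarrow> dist (X m) (X n) < r / 2"
      by (meson metric_CauchyD half_gt_zero)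
    have "dist (X n) y < r" if "n \<ge> M" for n
    proof -
      have "(norm (X n - y))\<^sup>2 \<le> (r / 2)\<^sup>2"
        unfolding norm_ell2_square minus_ell2.rep_eq y
        by (rule infsum_le_finite_sums) (use diff[OF M that] bound[OF _ M that] in auto)
      then have "norm (X n - y) \<le> r / 2"
        by (rule power2_le_imp_le) (use \<open>0 < r\<close> in simp)
      with \<open>0 < r\<close> show ?thesis by (simp add: dist_norm)
    qed
    then show "\<exists>M. \<forall>n\<ge>M. dist (X n) y < r" by blast
  qed
  then show "convergent X" unfolding convergent_def by blast
qed

instance ell2 :: banach ..


section \<open>The operators of the lattice equation\<close>

lift_definition Lap :: "ell2 \<Rightarrow> ell2" is "\<lambda>u i. u (i - 1) - 2 * u i + u (i + 1)"
proof -
  fix u :: "int \<Rightarrow> real"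
  assume u: "(\<lambda>i. (u i)\<^sup>2) summable_on UNIV"
  have "(\<lambda>i. (u (i + - 1) + (- 2) * u i + u (i + 1))\<^sup>2) summable_on UNIV"
    by (intro square_summable_add square_summable_cmult square_summable_shift u)
  then show "(\<lambda>i. (u (i - 1) - 2 * u i + u (i + 1))\<^sup>2) summable_on UNIV" by simp
qed

definition lipschitz_on_bounded_sets :: "(real \<Rightarrow> real) \<Rightarrow> bool"
  where "lipschitz_on_bounded_sets F \<longleftrightarrow> (\<forall>B. bounded B \<longrightarrow> (\<exists>L. L-lipschitz_on B F))"

text \<open>
  The superposition operator \<open>(F(u\<^sub>i))\<^sub>i\<close>. The abstraction function of the type is meaningful only on
  square-summable sequences; \<open>nth_superpos\<close> below shows that this is the case for all arguments
  when \<open>F 0 = 0\<close> and \<open>F\<close> is Lipschitz on bounded sets.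
\<close>
definition superpos :: "(real \<Rightarrow> real) \<Rightarrow> ell2 \<Rightarrow> ell2"
  where "superpos F u = Abs_ell2 (\<lambda>i. F (nth_ell2 u i))"

lemma nth_superpos:
  assumes F: "lipschitz_on_bounded_sets F" and "F 0 = 0"
  shows "nth_ell2 (superpos F u) i = F (nth_ell2 u i)"
proof -
  obtain L where L: "L-lipschitz_on {- norm u..norm u} F"
    using F bounded_closed_interval unfolding lipschitz_on_bounded_sets_def by metis
  have le: "\<bar>F (nth_ell2 u i)\<bar> \<le> \<bar>L * nth_ell2 u i\<bar>" for i
    using lipschitz_onD[OF L, of "nth_ell2 u i" 0] abs_nth_le_norm_ell2[of u i]
      lipschitz_on_nonneg[OF L] \<open>F 0 = 0\<close>
    by (auto simp: abs_mult dist_real_def abs_le_iff)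
  have "(\<lambda>i. (F (nth_ell2 u i))\<^sup>2) summable_on UNIV"
    by (rule summable_on_comparison_test[OF square_summable_cmult[OF square_summable, of L u]])
      (use le in \<open>auto simp: abs_le_square_iff\<close>)
  then show ?thesis unfolding superpos_def by (simp add: Abs_ell2_inverse)
qed


section \<open>The space of continuous functions and the hull of a function\<close>

definition C_space :: "(real \<Rightarrow> 'a::real_normed_vector) set"
  where "C_space = {f. continuous_on UNIV f}"

definition C_dist :: "(real \<Rightarrow> 'a::real_normed_vector) \<Rightarrow> (real \<Rightarrow> 'a) \<Rightarrow> real"
  where "C_dist f g = (SUP L\<in>{0<..}. min (SUP t\<in>{-L..L}. norm (f t - g t)) (1 / L))"

context
begin

private abbreviation S :: "(real \<Rightarrow> 'a::real_normed_vector) \<Rightarrow> (real \<Rightarrow> 'a) \<Rightarrow> real \<Rightarrow> real"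
  where "S f g L \<equiv> (SUP t\<in>{-L..L}. norm (f t - g t))"

private lemma bdd_S:
  assumes "f \<in> C_space" "g \<in> C_space"
  shows "bdd_above ((\<lambda>t. norm (f t - g t)) ` {-L..L})"
proof -
  have "compact ((\<lambda>t. norm (f t - g t)) ` {-L..L})"
    using assms unfolding C_space_def
    by (intro compact_continuous_image continuous_intros) (auto intro: continuous_on_subset)
  then show ?thesis by (intro bounded_imp_bdd_above compact_imp_bounded)
qed

private lemma le_S: "f \<in> C_space \<Longrightarrow> g \<in> C_space \<Longrightarrow> \<bar>t\<bar> \<le> L \<Longrightarrow> norm (f t - g t) \<le> S f g L"
  by (rule cSUP_upper[OF _ bdd_S]) auto

private lemma S_nonneg: "f \<in> C_space \<Longrightarrow> g \<in> C_space \<Longrightarrow> 0 < L \<Longrightarrow> 0 \<le> S f g L"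
  using le_S[of f g 0 L] norm_ge_zero[of "f 0 - g 0"] by linarith

private lemma bdd_C_dist:
  assumes "f \<in> C_space" "g \<in> C_space"
  shows "bdd_above ((\<lambda>L. min (S f g L) (1 / L)) ` {0<..})"
proof (rule bdd_aboveI2[where M = "max (S f g 1) 1"])
  fix L :: real assume L: "L \<in> {0<..}"
  show "min (S f g L) (1 / L) \<le> max (S f g 1) 1"
  proof (cases "L \<le> 1")
    case True
    then have "S f g L \<le> S f g 1"
      using L assms by (intro cSUP_subset_mono bdd_S) auto
    then show ?thesis by linarith
  next
    case False
    then have "1 / L \<le> 1" by simp
    then show ?thesis by linarith
  qed
qed

private lemma le_C_dist:
  "f \<in> C_space \<Longrightarrow> g \<in> C_space \<Longrightarrow> 0 < L \<Longrightarrow> min (S f g L) (1 / L) \<le> C_dist f g"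
  unfolding C_dist_def by (rule cSUP_upper[OF _ bdd_C_dist]) auto

text \<open>
  Off the carrier \<open>C_space\<close> the suprema in \<open>C_dist\<close> may be taken over unbounded sets, so the
  metric is cut off to the carrier, as \<open>Metric_space\<close> requires nonnegativity everywhere.
\<close>
definition C_metric :: "(real \<Rightarrow> 'a::real_normed_vector) \<Rightarrow> (real \<Rightarrow> 'a) \<Rightarrow> real"
  where "C_metric f g = (if f \<in> C_space \<and> g \<in> C_space then C_dist f g else 0)"

lemma Metric_space_C: "Metric_space C_space (C_metric :: (real \<Rightarrow> 'a::real_normed_vector) \<Rightarrow> _)"
proof
  fix f g h :: "real \<Rightarrow> 'a"
  have nonneg: "0 \<le> C_dist f g" if "f \<in> C_space" "g \<in> C_space" for f g :: "real \<Rightarrow> 'a"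
    using le_C_dist[OF that, of 1] S_nonneg[OF that, of 1] by simp
  then show "0 \<le> C_metric f g" by (simp add: C_metric_def)
  show "C_metric f g = C_metric g f"
    by (simp add: C_metric_def C_dist_def norm_minus_commute conj_commute)
  show "C_metric f g = 0 \<longleftrightarrow> f = g" if fg: "f \<in> C_space" "g \<in> C_space"
  proof
    assume "C_metric f g = 0"
    then have 0: "C_dist f g = 0" using fg by (simp add: C_metric_def)
    show "f = g"
    proof
      fix t
      have "min (S f g (\<bar>t\<bar> + 1)) (1 / (\<bar>t\<bar> + 1)) \<le> 0"
        using le_C_dist[OF fg, of "\<bar>t\<bar> + 1"] 0 by simp
      moreover have "0 < 1 / (\<bar>t\<bar> + 1)" by simp
      ultimately have "S f g (\<bar>t\<bar> + 1) \<le> 0" by linarith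
      moreover have "norm (f t - g t) \<le> S f g (\<bar>t\<bar> + 1)" by (rule le_S[OF fg]) simp
      ultimately have "norm (f t - g t) \<le> 0" by linarith
      then show "f t = g t" by simp
    qed
  next
    assume "f = g"
    have "(\<lambda>L. min (S f f L) (1 / L)) ` {0<..} = (\<lambda>L. 0) ` {0::real<..}"
      by (rule image_cong) (auto simp: min_def)
    then have "C_dist f f = (SUP L\<in>{0::real<..}. (0::real))"
      unfolding C_dist_def by (rule arg_cong)
    also have "\<dots> = 0" by simp
    finally show "C_metric f g = 0" using \<open>f = g\<close> by (simp add: C_metric_def)
  qed
  show "C_metric f h \<le> C_metric f g + C_metric g h"
    if f: "f \<in> C_space" and g: "g \<in> C_space" and h: "h \<in> C_space"
  proof -
    have "C_dist f h \<le> C_dist f g + C_dist g h"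
      unfolding C_dist_def[of f h]
    proof (rule cSUP_least)
      fix L :: real assume "L \<in> {0<..}"
      then have L: "0 < L" by simp
      have "S f h L \<le> S f g L + S g h L"
      proof (rule cSUP_least)
        fix t assume "t \<in> {-L..L}"
        then have "\<bar>t\<bar> \<le> L" by auto
        then show "norm (f t - h t) \<le> S f g L + S g h L"
          using norm_triangle_ineq[of "f t - g t" "g t - h t"] le_S[OF f g, of t L] le_S[OF g h, of t L]
          by simp
      qed (use L in auto)
      then have "min (S f h L) (1 / L) \<le> min (S f g L) (1 / L) + min (S g h L) (1 / L)"
        using S_nonneg[OF f g L] S_nonneg[OF g h L] L divide_pos_pos[of 1 L] by linarith
      also have "\<dots> \<le> C_dist f g + C_dist g h"
        by (intro add_mono le_C_dist f g h L)
      finally show "min (S f h L) (1 / L) \<le> C_dist f g + C_dist g h" .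
    qed auto
    then show ?thesis using f g h by (simp add: C_metric_def)
  qed
qed

end

definition C_topology :: "(real \<Rightarrow> 'a::real_normed_vector) topology"
  where "C_topology = Metric_space.mtopology C_space C_metric"

definition translate :: "real \<Rightarrow> (real \<Rightarrow> 'a) \<Rightarrow> real \<Rightarrow> 'a"
  where "translate h f = (\<lambda>t. f (t + h))"

definition hull_of :: "(real \<Rightarrow> 'a::real_normed_vector) \<Rightarrow> (real \<Rightarrow> 'a) set"
  where "hull_of f = C_topology closure_of (range (\<lambda>h. translate h f))"

text \<open>Precompact means relatively compact, i.e. having compact closure in \<open>C_topology\<close>.\<close>
definition translation_compact :: "(real \<Rightarrow> 'a::real_normed_vector) \<Rightarrow> bool"
  where "translation_compact f \<longleftrightarrow>
    compactin C_topology (C_topology closure_of (range (\<lambda>h. translate h f)))"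


section \<open>Solutions\<close>

text \<open>
  Classical solutions on \<open>[0, \<infinity>)\<close>, with a one-sided derivative at \<open>0\<close>. A solution is represented by
  a function on all of \<open>real\<close>; its values at negative times are irrelevant.
\<close>
definition solution_from ::
    "real \<Rightarrow> real \<Rightarrow> (real \<Rightarrow> real) \<Rightarrow> (real \<Rightarrow> ell2) \<Rightarrow> ell2 \<Rightarrow> (real \<Rightarrow> ell2) \<Rightarrow> bool"
  where "solution_from \<nu> lam F g v u \<longleftrightarrow>
    u 0 = v \<and>
    (\<forall>t\<ge>0. (u has_vector_derivative (\<nu> *\<^sub>R Lap (u t) - lam *\<^sub>R u t + superpos F (u t) + g t))
       (at t within {0..}))"

end

theory Submission
  imports Defs
begin

text \<open>
  The right-hand side is dissipative: \<open>\<langle>\<Lambda>u, u\<rangle> \<le> 0\<close> because the shifts are isometries, and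
  \<open>\<langle>F(u), u\<rangle> \<le> 0\<close> by the sign condition. A Gronwall estimate for \<open>\<parallel>u\<parallel>\<^sup>2\<close> therefore bounds
  solutions on every interval \<open>[0, T]\<close>, and so only the values of \<open>F\<close> on a bounded interval matter,
  where \<open>F\<close> is Lipschitz. The same estimate for the difference of two solutions gives uniqueness
  and continuous dependence on \<open>v\<close> and \<open>g\<close>.
\<close>

section \<open>Gronwall's inequality and Picard iteration in abstract spaces\<close>

text \<open>The squared norm is differentiable even where \<open>w\<close> vanishes, with derivative
  \<open>2 * (w t \<bullet> w' t)\<close>. Young's inequality absorbs
  \<open>2 * e * norm (w t)\<close> into \<open>e\<^sup>2 + (norm (w t))\<^sup>2\<close>, which
  explains the rate \<open>2 * K + 1\<close>.\<close>

lemma gronwall_inner: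
  fixes w :: "real \<Rightarrow> 'a::real_inner"
  assumes deriv: "\<And>t. t \<in> {0..T} \<Longrightarrow> (w has_vector_derivative w' t) (at t within {0..T})"
    and le: "\<And>t. t \<in> {0..T} \<Longrightarrow> w t \<bullet> w' t \<le> K * (norm (w t))\<^sup>2 + e * norm (w t)"
    and t: "t \<in> {0..T}" and "0 \<le> K"
  shows "(norm (w t))\<^sup>2 \<le> exp ((2 * K + 1) * t) * ((norm (w 0))\<^sup>2 + e\<^sup>2 * t)"
    (is "_ \<le> exp (?M * t) * _")
proof -
  \<comment> \<open>The exponential is the integrating factor. It is at most 1 at nonnegative times,
    so subtracting \<open>e\<^sup>2 * s\<close> compensates the forcing and makes \<open>y\<close>
    nonincreasing.\<close>
  define y where "y s = exp (- (?M * s)) * (w s \<bullet> w s) - e\<^sup>2 * s" for s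
  define y' where "y' s = exp (- (?M * s)) * (2 * (w s \<bullet> w' s) - ?M * (w s \<bullet> w s)) - e\<^sup>2" for s
  have y': "(y has_real_derivative y' s) (at s within {0..t})" if "s \<in> {0..t}" for s
  proof -
    have "(w has_derivative (\<lambda>h. h *\<^sub>R w' s)) (at s within {0..t})"
      using deriv[of s] that t has_vector_derivative_within_subset[of w "w' s" s "{0..T}" "{0..t}"]
      by (auto simp: has_vector_derivative_def)
    from has_derivative_inner[OF this this]
    have "((\<lambda>s. w s \<bullet> w s) has_real_derivative 2 * (w s \<bullet> w' s)) (at s within {0..t})"
      by (rule has_derivative_imp_has_field_derivative) (simp add: inner_commute)
    then show ?thesis unfolding y_def y'_def
      by (auto intro!: derivative_eq_intros simp: algebra_simps)
  qed
  have nonpos: "y' s \<le> 0" if "s \<in> {0..t}" for s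
  proof -
    have "2 * e * norm (w s) \<le> e\<^sup>2 + (norm (w s))\<^sup>2"
      using sum_squares_bound[of e "norm (w s)"] by simp
    with le[of s] that t have "2 * (w s \<bullet> w' s) - ?M * (w s \<bullet> w s) \<le> e\<^sup>2"
      by (simp add: power2_norm_eq_inner algebra_simps)
    then have "exp (- (?M * s)) * (2 * (w s \<bullet> w' s) - ?M * (w s \<bullet> w s)) \<le> exp (- (?M * s)) * e\<^sup>2"
      by (intro mult_left_mono) auto
    also have "\<dots> \<le> 1 * e\<^sup>2"
      using that \<open>0 \<le> K\<close> by (intro mult_right_mono) auto
    finally show ?thesis by (simp add: y'_def)
  qed
  have "y t \<le> y 0"
  proof (rule DERIV_nonpos_imp_decreasing_open[where f = y])
    show "\<exists>d. (y has_real_derivative d) (at s) \<and> d \<le> 0" if "0 < s" "s < t" for s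
      using y'[of s] nonpos[of s] that by (auto simp: at_within_Icc_at)
    show "continuous_on {0..t} y"
      using y' by (rule DERIV_continuous_on)
  qed (use t in auto)
  then have "exp (- (?M * t)) * (w t \<bullet> w t) \<le> w 0 \<bullet> w 0 + e\<^sup>2 * t"
    by (simp add: y_def)
  then have "exp (?M * t) * (exp (- (?M * t)) * (w t \<bullet> w t)) \<le> exp (?M * t) * (w 0 \<bullet> w 0 + e\<^sup>2 * t)"
    by (intro mult_left_mono) auto
  then show ?thesis
    by (simp add: power2_norm_eq_inner mult.assoc[symmetric] exp_add[symmetric])
qed

text \<open>
  The weight \<open>exp (- M * t)\<close> makes the Picard operator a contraction on an interval of any length.
\<close>
lemma lipschitz_ode_solution_exists:
  fixes A :: "'a::banach \<Rightarrow> 'a" and g :: "real \<Rightarrow> 'a"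
  assumes A: "L-lipschitz_on UNIV A" and g: "continuous_on {0..T} g" and T: "0 \<le> T"
  shows "\<exists>u. u 0 = v \<and> (\<forall>t\<in>{0..T}. (u has_vector_derivative (A (u t) + g t)) (at t within {0..T}))"
proof -
  have L: "0 \<le> L" using A by (rule lipschitz_on_nonneg)
  \<comment> \<open>The \<open>+ 1\<close> keeps \<open>M\<close> positive and
    \<open>L / M < 1\<close> even when \<open>L = 0\<close>.\<close>
  define M where "M = L + 1"
  \<comment> \<open>Retracting the line onto \<open>{0..T}\<close> extends curves on the interval to
    bounded continuous functions on \<open>real\<close>, so the fixed point is sought in a complete
    type.\<close>
  define p where "p t = max 0 (min T t)" for t
  have p: "p t \<in> {0..T}" "t \<in> {0..T} \<Longrightarrow> p t = t" for t using T by (auto simp: p_def)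
  \<comment> \<open>On \<open>{0..T}\<close> the unknown \<open>w\<close> stands for
    \<open>exp (- (M * t)) *\<^sub>R u t\<close>. \<open>N\<close> is the right-hand side along
    \<open>u\<close>, \<open>I\<close> the Picard integral, and \<open>Q\<close> this integral
    weighted again.\<close>
  define N where "N w r = A (exp (M * r) *\<^sub>R apply_bcontfun w r) + g r" for w :: "real \<Rightarrow>\<^sub>C 'a" and r
  define I where "I w s = v + integral {0..s} (N w)" for w s
  define Q where "Q w t = exp (- (M * p t)) *\<^sub>R I w (p t)" for w t
  have N: "continuous_on {0..T} (N w)" for w
    unfolding N_def
    by (intro continuous_intros g continuous_on_compose2[OF lipschitz_on_continuous_on[OF A]]) auto
  have I: "continuous_on {0..T} (I w)" for w
    unfolding I_def
    by (intro continuous_intros indefinite_integral_continuous_1 integrable_continuous_real N)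
  have Q: "Q w \<in> bcontfun" for w
  proof -
    have c: "continuous_on {0..T} (\<lambda>s. exp (- (M * s)) *\<^sub>R I w s)"
      by (intro continuous_intros I)
    have "continuous_on UNIV (Q w)" unfolding Q_def
      by (rule continuous_on_compose2[OF c]) (use p in \<open>auto simp: p_def intro!: continuous_intros\<close>)
    moreover have "bounded (range (Q w))"
      by (rule bounded_subset[OF compact_imp_bounded[OF compact_continuous_image[OF c]]])
        (use p in \<open>auto simp: Q_def\<close>)
    ultimately show ?thesis by (simp add: bcontfun_def)
  qed
  have lip: "dist (Bcontfun (Q w)) (Bcontfun (Q z)) \<le> L / M * dist w z" for w z
  proof (rule dist_bound)
    fix t
    define s where "s = p t"
    have s: "0 \<le> s" "s \<le> T" using p[of t] by (auto simp: s_def)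
    have int: "N w integrable_on {0..s}" for w
      by (rule integrable_continuous_real[OF continuous_on_subset[OF N]]) (use s in auto)
    \<comment> \<open>Integrating the weight gains the factor \<open>1 / M\<close>, which beats the
      Lipschitz constant \<open>L\<close>.\<close>
    have exp_int: "((\<lambda>r. L * dist w z * exp (M * r)) has_integral
        L * dist w z / M * exp (M * s) - L * dist w z / M * exp (M * 0)) {0..s}"
      using L s by (intro fundamental_theorem_of_calculus)
        (auto simp: has_real_derivative_iff_has_vector_derivative[symmetric] M_def intro!: derivative_eq_intros)
    have "norm (I w s - I z s) = norm (integral {0..s} (\<lambda>r. N w r - N z r))"
      by (simp add: I_def integral_diff int)
    also have "\<dots> \<le> integral {0..s} (\<lambda>r. L * dist w z * exp (M * r))"
    proof (rule integral_norm_bound_integral)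
      fix r
      have "norm (N w r - N z r) \<le> L * norm (exp (M * r) *\<^sub>R apply_bcontfun w r - exp (M * r) *\<^sub>R apply_bcontfun z r)"
        using lipschitz_onD[OF A] by (simp add: N_def dist_norm)
      also have "\<dots> = L * (exp (M * r) * dist (apply_bcontfun w r) (apply_bcontfun z r))"
        by (simp add: dist_norm scaleR_diff_right[symmetric])
      also have "\<dots> \<le> L * (exp (M * r) * dist w z)"
        using L by (intro mult_left_mono dist_bounded) auto
      finally show "norm (N w r - N z r) \<le> L * dist w z * exp (M * r)" by (simp add: mult_ac)
    qed (use exp_int in \<open>auto intro!: integrable_diff int\<close>)
    also have "\<dots> = L * dist w z / M * exp (M * s) - L * dist w z / M"
      using integral_unique[OF exp_int] by simp
    also have "\<dots> \<le> L * dist w z / M * exp (M * s)" using L by (simp add: M_def)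
    finally have "exp (- (M * s)) * norm (I w s - I z s)
        \<le> exp (- (M * s)) * (L * dist w z / M * exp (M * s))"
      by (intro mult_left_mono) auto
    also have "\<dots> = L / M * dist w z" by (simp add: exp_minus)
    finally show "dist (apply_bcontfun (Bcontfun (Q w)) t) (apply_bcontfun (Bcontfun (Q z)) t) \<le> L / M * dist w z"
      by (simp add: Bcontfun_inverse[OF Q] dist_norm Q_def s_def[symmetric] scaleR_diff_right[symmetric])
  qed
  have "\<exists>!w. Bcontfun (Q w) = w"
    by (rule banach_fix_type[where c = "L / M"]) (use L lip in \<open>auto simp: M_def\<close>)
  then obtain w where w: "Bcontfun (Q w) = w" by blast
  define u where "u t = exp (M * t) *\<^sub>R apply_bcontfun w t" for t
  have u: "u t = I w t" if "t \<in> {0..T}" for t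
  proof -
    have "apply_bcontfun w t = Q w t" by (metis w Bcontfun_inverse[OF Q])
    then show ?thesis using p(2)[OF that] by (simp add: u_def Q_def exp_minus)
  qed
  show ?thesis
  proof (intro exI[of _ u] conjI ballI)
    show "u 0 = v" using u[of 0] T by (simp add: I_def)
    fix t assume t: "t \<in> {0..T}"
    have "(I w has_vector_derivative 0 + N w t) (at t within {0..T})"
      unfolding I_def by (intro has_vector_derivative_add has_vector_derivative_const
          integral_has_vector_derivative N t)
    then have "(u has_vector_derivative N w t) (at t within {0..T})"
      by (intro has_vector_derivative_transform[OF t u]) auto
    then show "(u has_vector_derivative (A (u t) + g t)) (at t within {0..T})"
      by (simp add: N_def u_def)
  qed
qed

section \<open>Coordinatewise bounds, shifts and the discrete Laplacian on
  \<open>ell2\<close>\<close>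

lemma norm_ell2_le:
  assumes "\<And>i. \<bar>nth_ell2 x i\<bar> \<le> c * \<bar>nth_ell2 y i\<bar>" and "0 \<le> c"
  shows "norm x \<le> c * norm y"
proof (rule power2_le_imp_le)
  have "(nth_ell2 x i)\<^sup>2 \<le> c\<^sup>2 * (nth_ell2 y i)\<^sup>2" for i
    using power_mono[OF assms(1)[of i], of 2] by (simp add: power_mult_distrib)
  then have "(norm x)\<^sup>2 \<le> (\<Sum>\<^sub>\<infinity>i. c\<^sup>2 * (nth_ell2 y i)\<^sup>2)"
    unfolding norm_ell2_square
    by (intro infsum_mono square_summable summable_on_cmult_right)
  also have "\<dots> = (c * norm y)\<^sup>2"
    by (simp add: norm_ell2_square infsum_cmult_right' power_mult_distrib)
  finally show "(norm x)\<^sup>2 \<le> (c * norm y)\<^sup>2" .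
qed (use assms in auto)

lift_definition shift :: "int \<Rightarrow> ell2 \<Rightarrow> ell2" is "\<lambda>k u i. u (i + k)"
  by (rule square_summable_shift)

lemma norm_shift: "norm (shift k u) = norm u"
proof -
  have "bij_betw (\<lambda>i. i + k) UNIV (UNIV :: int set)"
    by (rule bij_betwI[where g = "\<lambda>i. i - k"]) auto
  from infsum_reindex_bij_betw[OF this, of "\<lambda>i. (nth_ell2 u i)\<^sup>2"]
  show ?thesis by (simp add: norm_ell2_def shift.rep_eq)
qed

lemma Lap_eq_shift: "Lap u = shift (- 1) u + shift 1 u - 2 *\<^sub>R u"
  by transfer auto

lemma Lap_diff: "Lap (u - w) = Lap u - Lap w"
  by transfer (auto simp: algebra_simps)

text \<open>Cauchy-Schwarz and the isometry of the shifts bound each of the two neighbour terms by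
  \<open>u \<bullet> u\<close>; the diagonal term subtracts exactly twice that.\<close>

lemma inner_Lap_nonpos: "u \<bullet> Lap u \<le> 0"
proof -
  have "u \<bullet> shift k u \<le> u \<bullet> u" for k
    using norm_cauchy_schwarz[of u "shift k u"] by (simp add: norm_shift power2_norm_eq_inner[symmetric] power2_eq_square)
  from this[of "- 1"] this[of 1] show ?thesis
    by (simp add: Lap_eq_shift inner_diff_right inner_add_right)
qed

lemma norm_Lap_le: "norm (Lap u) \<le> 4 * norm u"
  using norm_triangle_ineq4[of "shift (- 1) u + shift 1 u" "2 *\<^sub>R u"]
    norm_triangle_ineq[of "shift (- 1) u" "shift 1 u"]
  by (simp add: Lap_eq_shift norm_shift)

section \<open>Closeness in \<open>C_metric\<close> and continuity of the members of the
  hull\<close>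

text \<open>The cutoff \<open>1 / L\<close> is at least \<open>d\<close>, so a distance below
  \<open>d\<close> forces the supremum over \<open>{- L..L}\<close>, and not the cutoff, to be the
  smaller entry of the minimum.\<close>

lemma C_metric_less_imp_norm_less:
  assumes f: "f \<in> C_space" and g: "g \<in> C_space" and d: "C_metric f g < d" "d \<le> 1 / L"
    and t: "\<bar>t\<bar> \<le> L" and L: "0 < L"
  shows "norm (f t - g t) < d"
proof -
  define S where "S K = (SUP t\<in>{- K..K}. norm (f t - g t))" for K
  have bdd: "bdd_above ((\<lambda>t. norm (f t - g t)) ` {- K..K})" for K
    using f g unfolding C_space_def
    by (intro bounded_imp_bdd_above compact_imp_bounded compact_continuous_image continuous_intros)
      (auto intro: continuous_on_subset)
  \<comment> \<open>A real supremum is known to dominate its members only over a set bounded above,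
    so a bound uniform in \<open>K\<close> comes first.\<close>
  have "min (S K) (1 / K) \<le> max (S 1) 1" if "0 < K" for K
  proof (cases "K \<le> 1")
    case True
    then have "S K \<le> S 1"
      unfolding S_def using that by (intro cSUP_subset_mono bdd) auto
    then show ?thesis by linarith
  next
    case False
    then have "1 / K \<le> 1" by simp
    then show ?thesis by linarith
  qed
  then have "bdd_above ((\<lambda>K. min (S K) (1 / K)) ` {0<..})"
    by (intro bdd_aboveI2[where M = "max (S 1) 1"]) auto
  then have "min (S L) (1 / L) \<le> C_dist f g"
    unfolding C_dist_def S_def[symmetric] using L by (intro cSUP_upper) auto
  with d f g have "S L < d" by (simp add: C_metric_def min_def split: if_splits)
  moreover have "norm (f t - g t) \<le> S L"
    unfolding S_def using t by (intro cSUP_upper bdd) auto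
  ultimately show ?thesis by simp
qed

lemma hull_of_subset_C_space: "hull_of f \<subseteq> C_space"
  using closure_of_subset_topspace Metric_space.topspace_mtopology[OF Metric_space_C]
  unfolding hull_of_def C_topology_def by metis

lemma translate_in_C_space: "g \<in> C_space \<Longrightarrow> translate h g \<in> C_space"
  unfolding C_space_def translate_def mem_Collect_eq
  by (rule continuous_on_compose2[of UNIV g]) (auto intro!: continuous_intros)


section \<open>Dissipativity and Lipschitz bounds for the right-hand side\<close>

text \<open>The sign condition, unlike a bound by \<open>- \<alpha> * s\<^sup>2\<close> with
  positive \<open>\<alpha>\<close>, survives when \<open>F\<close> is cut off to a bounded function.
  This lets the locale be interpreted a second time for the cut-off equation.\<close>

locale lattice_ode =
  fixes \<nu> lam :: real and F :: "real \<Rightarrow> real"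
  assumes nu: "0 \<le> \<nu>" and lam: "0 \<le> lam"
    and lipschitz_F: "lipschitz_on_bounded_sets F" and F_0: "F 0 = 0"
    and dissipative: "s * F s \<le> 0"
begin

definition rhs :: "ell2 \<Rightarrow> ell2"
  where "rhs u = \<nu> *\<^sub>R Lap u - lam *\<^sub>R u + superpos F u"

definition solution_on :: "real \<Rightarrow> (real \<Rightarrow> ell2) \<Rightarrow> ell2 \<Rightarrow> (real \<Rightarrow> ell2) \<Rightarrow> bool"
  where "solution_on T g v u \<longleftrightarrow>
    u 0 = v \<and> (\<forall>t\<in>{0..T}. (u has_vector_derivative (rhs (u t) + g t)) (at t within {0..T}))"

lemma nth_superpos_F: "nth_ell2 (superpos F u) i = F (nth_ell2 u i)"
  by (rule nth_superpos[OF lipschitz_F F_0])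

lemma inner_rhs_nonpos: "u \<bullet> rhs u \<le> 0"
proof -
  have "u \<bullet> superpos F u \<le> 0"
    unfolding inner_ell2_def nth_superpos_F using infsum_nonneg[of UNIV "\<lambda>i. - (nth_ell2 u i * F (nth_ell2 u i))"] dissipative by (simp add: infsum_uminus)
  moreover have "\<nu> * (u \<bullet> Lap u) \<le> 0" "0 \<le> lam * (u \<bullet> u)"
    using nu lam inner_Lap_nonpos[of u] by (auto simp: mult_nonneg_nonpos)
  ultimately show ?thesis by (simp add: rhs_def inner_add_right inner_diff_right)
qed

text \<open>Every coordinate is bounded by the norm, so one Lipschitz constant of \<open>F\<close>
  on \<open>{- R..R}\<close> serves all coordinates at once.\<close>

lemma superpos_lipschitz:
  assumes L: "L-lipschitz_on {- R..R} F" and "norm u \<le> R" "norm w \<le> R"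
  shows "norm (superpos F u - superpos F w) \<le> L * norm (u - w)"
proof (rule norm_ell2_le)
  fix i
  have "nth_ell2 u i \<in> {- R..R}" "nth_ell2 w i \<in> {- R..R}"
    using abs_nth_le_norm_ell2[of u i] abs_nth_le_norm_ell2[of w i] assms(2,3) by auto
  from lipschitz_onD[OF L this]
  show "\<bar>nth_ell2 (superpos F u - superpos F w) i\<bar> \<le> L * \<bar>nth_ell2 (u - w) i\<bar>"
    by (simp add: minus_ell2.rep_eq nth_superpos_F dist_real_def)
qed (rule lipschitz_on_nonneg[OF L])

lemma rhs_diff:
  "rhs u - rhs w = \<nu> *\<^sub>R Lap (u - w) - lam *\<^sub>R (u - w) + (superpos F u - superpos F w)"
  by (simp add: rhs_def Lap_diff algebra_simps)

text \<open>The linear part contributes nonpositively, so \<open>L\<close> alone can serve as the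
  constant \<open>K\<close> of \<open>gronwall_inner\<close>.\<close>

lemma inner_rhs_diff_le:
  assumes L: "L-lipschitz_on {- R..R} F" and "norm u \<le> R" "norm w \<le> R"
  shows "(u - w) \<bullet> (rhs u - rhs w) \<le> L * (norm (u - w))\<^sup>2"
proof -
  have "(u - w) \<bullet> (superpos F u - superpos F w) \<le> norm (u - w) * (L * norm (u - w))"
    by (rule order_trans[OF norm_cauchy_schwarz mult_left_mono[OF superpos_lipschitz[OF assms]]]) simp
  moreover have "\<nu> * ((u - w) \<bullet> Lap (u - w)) \<le> 0" "0 \<le> lam * ((u - w) \<bullet> (u - w))"
    using nu lam inner_Lap_nonpos[of "u - w"] by (auto simp: mult_nonneg_nonpos)
  ultimately show ?thesis
    unfolding rhs_diff inner_add_right inner_diff_right[of _ "\<nu> *\<^sub>R _"] inner_scaleR_right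
    by (simp add: power2_eq_square mult_ac)
qed

text \<open>Picard iteration needs a bound in norm, which the one-sided estimate does not give. This
  one is meant for the cut-off nonlinearity; the 4 bounds the norm of \<open>Lap\<close>.\<close>

lemma rhs_lipschitz:
  assumes L: "L-lipschitz_on UNIV F"
  shows "(4 * \<nu> + lam + L)-lipschitz_on UNIV rhs"
proof (rule lipschitz_onI)
  fix u w :: ell2
  define R where "R = max (norm u) (norm w)"
  have "norm (\<nu> *\<^sub>R Lap (u - w)) \<le> 4 * \<nu> * norm (u - w)" "norm (lam *\<^sub>R (u - w)) \<le> lam * norm (u - w)"
    using nu lam mult_left_mono[OF norm_Lap_le[of "u - w"] nu] by (auto simp: mult_ac)
  moreover have "norm (superpos F u - superpos F w) \<le> L * norm (u - w)"
    by (rule superpos_lipschitz[where R = R]) (auto intro: lipschitz_on_subset[OF L] simp: R_def)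
  ultimately show "dist (rhs u) (rhs w) \<le> (4 * \<nu> + lam + L) * dist u w"
    unfolding dist_norm rhs_diff
    using norm_triangle_ineq[of "\<nu> *\<^sub>R Lap (u - w) - lam *\<^sub>R (u - w)" "superpos F u - superpos F w"]
      norm_triangle_ineq4[of "\<nu> *\<^sub>R Lap (u - w)" "lam *\<^sub>R (u - w)"]
    by (simp add: algebra_simps)
qed (use nu lam lipschitz_on_nonneg[OF L] in simp)

section \<open>A priori bounds, uniqueness and existence on compact intervals\<close>

lemma solution_on_subset: "solution_on T g v u \<Longrightarrow> T' \<le> T \<Longrightarrow> solution_on T' g v u"
  unfolding solution_on_def
  by (auto intro!: has_vector_derivative_within_subset[of _ _ _ "{0..T}" "{0..T'}"])

lemma solution_from_imp_solution_on: "solution_from \<nu> lam F g v u \<Longrightarrow> solution_on T g v u"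
  unfolding solution_on_def solution_from_def rhs_def
  by (auto intro!: has_vector_derivative_within_subset[of _ _ _ "{0..}" "{0..T}"])

lemma solution_on_continuous: "solution_on T g v u \<Longrightarrow> continuous_on {0..T} u"
  unfolding solution_on_def by (auto intro: continuous_on_vector_derivative)

text \<open>Dissipativity permits \<open>K = 0\<close> in \<open>gronwall_inner\<close>. The
  resulting bound does not involve \<open>F\<close>, so a radius can be fixed before
  \<open>F\<close> is cut off or a Lipschitz constant is chosen.\<close>

lemma solution_on_bound:
  assumes u: "solution_on T g v u" and g: "\<And>t. t \<in> {0..T} \<Longrightarrow> norm (g t) \<le> G" and t: "t \<in> {0..T}"
  shows "norm (u t) \<le> sqrt (exp T * ((norm v)\<^sup>2 + G\<^sup>2 * T))"
proof (rule real_le_rsqrt)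
  have "(norm (u t))\<^sup>2 \<le> exp ((2 * 0 + 1) * t) * ((norm (u 0))\<^sup>2 + G\<^sup>2 * t)"
  proof (rule gronwall_inner)
    show "(u has_vector_derivative (rhs (u s) + g s)) (at s within {0..T})" if "s \<in> {0..T}" for s
      using u that by (simp add: solution_on_def)
    fix s assume s: "s \<in> {0..T}"
    have "u s \<bullet> g s \<le> norm (u s) * G"
      by (rule order_trans[OF norm_cauchy_schwarz mult_left_mono[OF g[OF s]]]) simp
    then show "u s \<bullet> (rhs (u s) + g s) \<le> 0 * (norm (u s))\<^sup>2 + G * norm (u s)"
      using inner_rhs_nonpos[of "u s"] by (simp add: inner_add_right mult.commute)
  qed (use t in auto)
  also have "\<dots> \<le> exp T * ((norm v)\<^sup>2 + G\<^sup>2 * T)"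
    using t u by (intro mult_mono add_mono mult_left_mono) (auto simp: solution_on_def)
  finally show "(norm (u t))\<^sup>2 \<le> exp T * ((norm v)\<^sup>2 + G\<^sup>2 * T)" .
qed

text \<open>The radius \<open>R\<close> is left open: uniqueness takes it from compactness of the
  two curves, continuous dependence from the a priori bound.\<close>

lemma solution_on_diff_bound:
  assumes u: "solution_on T g v u" and u': "solution_on T g' v' u'"
    and R: "\<And>t. t \<in> {0..T} \<Longrightarrow> norm (u t) \<le> R" "\<And>t. t \<in> {0..T} \<Longrightarrow> norm (u' t) \<le> R"
    and L: "L-lipschitz_on {- R..R} F"
    and e: "\<And>t. t \<in> {0..T} \<Longrightarrow> norm (g t - g' t) \<le> e" and t: "t \<in> {0..T}"
  shows "(norm (u t - u' t))\<^sup>2 \<le> exp ((2 * L + 1) * T) * ((norm (v - v'))\<^sup>2 + e\<^sup>2 * T)"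
proof -
  have L0: "0 \<le> L" using L by (rule lipschitz_on_nonneg)
  have "(norm (u t - u' t))\<^sup>2 \<le> exp ((2 * L + 1) * t) * ((norm (u 0 - u' 0))\<^sup>2 + e\<^sup>2 * t)"
  proof (rule gronwall_inner)
    show "((\<lambda>t. u t - u' t) has_vector_derivative (rhs (u s) + g s) - (rhs (u' s) + g' s)) (at s within {0..T})"
      if "s \<in> {0..T}" for s
      using u u' that by (intro has_vector_derivative_diff) (auto simp: solution_on_def)
    fix s assume s: "s \<in> {0..T}"
    have "(u s - u' s) \<bullet> (g s - g' s) \<le> norm (u s - u' s) * e"
      by (rule order_trans[OF norm_cauchy_schwarz mult_left_mono[OF e[OF s]]]) simp
    with inner_rhs_diff_le[OF L R(1)[OF s] R(2)[OF s]]
    show "(u s - u' s) \<bullet> ((rhs (u s) + g s) - (rhs (u' s) + g' s))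
        \<le> L * (norm (u s - u' s))\<^sup>2 + e * norm (u s - u' s)"
      unfolding add_diff_add inner_add_right by (simp add: mult.commute)
  qed (use t L0 in auto)
  also have "\<dots> \<le> exp ((2 * L + 1) * T) * ((norm (v - v'))\<^sup>2 + e\<^sup>2 * T)"
    using t u u' L0 by (intro mult_mono add_mono mult_left_mono) (auto simp: solution_on_def)
  finally show ?thesis .
qed

lemma F_lipschitz_on_interval: obtains L where "L-lipschitz_on {- R..R} F"
  using lipschitz_F bounded_closed_interval unfolding lipschitz_on_bounded_sets_def by metis

lemma solution_on_unique:
  assumes u: "solution_on T g v u" and u': "solution_on T g v u'" and t: "t \<in> {0..T}"
  shows "u t = u' t"
proof -
  have "bounded (u ` {0..T} \<union> u' ` {0..T})"
    using u u' by (intro bounded_Un[THEN iffD2] conjI compact_imp_bounded compact_continuous_image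
        solution_on_continuous) auto
  then obtain R where R: "\<And>t. t \<in> {0..T} \<Longrightarrow> norm (u t) \<le> R" "\<And>t. t \<in> {0..T} \<Longrightarrow> norm (u' t) \<le> R"
    by (metis bounded_iff imageI UnI1 UnI2)
  obtain L where "L-lipschitz_on {- R..R} F" by (rule F_lipschitz_on_interval)
  from solution_on_diff_bound[OF u u' R this, of 0] t show ?thesis by simp
qed

text \<open>
  Cutting \<open>F\<close> off outside an interval that contains the a priori bound makes the equation globally
  Lipschitz, keeps it dissipative and does not change it along the solution.
\<close>
lemma solution_on_exists:
  assumes g: "continuous_on {0..T} g" and T: "0 \<le> T"
  shows "\<exists>u. solution_on T g v u"
proof -
  have "bounded (g ` {0..T})"
    by (intro compact_imp_bounded compact_continuous_image g) auto
  then obtain G where G: "\<And>t. t \<in> {0..T} \<Longrightarrow> norm (g t) \<le> G"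
    by (metis bounded_iff imageI)
  \<comment> \<open>This is the a priori bound of \<open>solution_on_bound\<close>, which is the
    same for the original and the cut-off equation.\<close>
  define R where "R = sqrt (exp T * ((norm v)\<^sup>2 + G\<^sup>2 * T))"
  have R: "0 \<le> R" using T by (simp add: R_def)
  define clamp where "clamp s = max (- R) (min R s)" for s
  define F' where "F' s = F (clamp s)" for s
  obtain L where L: "L-lipschitz_on {- R..R} F" by (rule F_lipschitz_on_interval)
  have L': "L-lipschitz_on UNIV F'"
  proof (rule lipschitz_onI)
    fix s r
    have "dist (F' s) (F' r) \<le> L * dist (clamp s) (clamp r)"
      unfolding F'_def by (rule lipschitz_onD[OF L]) (use R in \<open>auto simp: clamp_def\<close>)
    also have "\<dots> \<le> L * dist s r"
      by (intro mult_left_mono lipschitz_on_nonneg[OF L]) (auto simp: clamp_def dist_real_def)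
    finally show "dist (F' s) (F' r) \<le> L * dist s r" .
  qed (rule lipschitz_on_nonneg[OF L])
  interpret cut: lattice_ode \<nu> lam F'
  proof
    show "lipschitz_on_bounded_sets F'"
      unfolding lipschitz_on_bounded_sets_def using lipschitz_on_subset[OF L'] by blast
    show "F' 0 = 0" using R F_0 by (simp add: F'_def clamp_def)
    show "s * F' s \<le> 0" for s
    proof -
      \<comment> \<open>Outside the interval \<open>F'\<close> is constant, and its sign is that of
        \<open>F\<close> at the nearer endpoint. The case \<open>R = 0\<close> is separate: there
        the sign condition at the endpoint says nothing, and \<open>F 0 = 0\<close> is used.\<close>
      consider "\<bar>s\<bar> \<le> R" | "R = 0" | "0 < R" "R < s" | "0 < R" "s < - R"
        using R by linarith
      then show ?thesis
      proof cases
        case 1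
        then show ?thesis using dissipative[of s] by (simp add: F'_def clamp_def abs_le_iff)
      next
        case 2
        then show ?thesis using F_0 by (simp add: F'_def clamp_def)
      next
        case 3
        then show ?thesis using dissipative[of R] by (simp add: F'_def clamp_def mult_le_0_iff)
      next
        case 4
        then show ?thesis using dissipative[of "- R"]
          by (simp add: F'_def clamp_def mult_le_0_iff zero_le_mult_iff)
      qed
    qed
  qed (rule nu lam)+
  obtain u where u: "cut.solution_on T g v u"
    using lipschitz_ode_solution_exists[OF cut.rhs_lipschitz[OF L'] g T, of v]
    unfolding cut.solution_on_def by blast
  have "cut.rhs (u t) = rhs (u t)" if t: "t \<in> {0..T}" for t
  proof -
    \<comment> \<open>There is no circularity: the bound is applied to the cut-off equation, which
      is itself dissipative.\<close>
    have "norm (u t) \<le> R" unfolding R_def by (rule cut.solution_on_bound[OF u G t])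
    then have "clamp (nth_ell2 (u t) i) = nth_ell2 (u t) i" for i
      using abs_nth_le_norm_ell2[of "u t" i] by (simp add: clamp_def)
    then have "superpos F' (u t) = superpos F (u t)"
      by (simp add: superpos_def F'_def)
    then show ?thesis by (simp add: rhs_def cut.rhs_def)
  qed
  with u have "solution_on T g v u"
    by (simp add: solution_on_def cut.solution_on_def)
  then show ?thesis by blast
qed

section \<open>Global solutions and the cocycle property\<close>

text \<open>By uniqueness the solutions on the intervals \<open>{0..T}\<close> agree where they
  overlap, so the diagonal \<open>U t t\<close> glues them together.\<close>

lemma solution_from_exists:
  assumes g: "g \<in> C_space"
  shows "\<exists>u. solution_from \<nu> lam F g v u"
proof -
  have "\<exists>u. solution_on T g v u" if "0 \<le> T" for T
    using g that by (intro solution_on_exists) (auto simp: C_space_def intro: continuous_on_subset)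
  then obtain U where U: "\<And>T. 0 \<le> T \<Longrightarrow> solution_on T g v (U T)" by metis
  define u where "u t = U t t" for t
  have eq: "u t = U T t" if "t \<in> {0..T}" for t T
    unfolding u_def
    by (rule solution_on_unique[where T = t and g = g and v = v and u = "U t" and u' = "U T"])
      (use that U solution_on_subset[OF U, of T t] in auto)
  have "(u has_vector_derivative (rhs (u t) + g t)) (at t within {0..})" if t: "0 \<le> t" for t
  proof -
    \<comment> \<open>The interval ends beyond \<open>t\<close>, so near \<open>t\<close> it
      coincides with \<open>{0..}\<close> and gives the same derivative, one-sided at 0.\<close>
    have "(U (t + 1) has_vector_derivative (rhs (u t) + g t)) (at t within {0..t + 1})"
      using U[of "t + 1"] t eq[of t "t + 1"] by (simp add: solution_on_def)
    then have "(u has_vector_derivative (rhs (u t) + g t)) (at t within {0..t + 1})"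
      by (intro has_vector_derivative_transform[OF _ eq]) (use t in auto)
    moreover have "at t within {0..} = at t within {0..t + 1}"
      by (rule at_within_nhd[of t "{..<t + 1}"]) auto
    ultimately show ?thesis by simp
  qed
  moreover have "u 0 = v" using U[of 0] by (simp add: u_def solution_on_def)
  ultimately have "solution_from \<nu> lam F g v u" by (simp add: solution_from_def rhs_def)
  then show ?thesis by blast
qed

lemma solution_from_unique:
  assumes "solution_from \<nu> lam F g v u" "solution_from \<nu> lam F g v u'" "0 \<le> t"
  shows "u t = u' t"
  using assms solution_on_unique[of t g v u u' t] by (simp add: solution_from_imp_solution_on)

text \<open>The choice of \<open>u\<close> does not depend on \<open>t\<close>, so a single solution
  is followed for each \<open>v\<close> and \<open>g\<close>.\<close>

definition flow :: "real \<Rightarrow> ell2 \<Rightarrow> (real \<Rightarrow> ell2) \<Rightarrow> ell2"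
  where "flow t v g = (SOME u. solution_from \<nu> lam F g v u) t"

lemma solution_flow: "g \<in> C_space \<Longrightarrow> solution_from \<nu> lam F g v (\<lambda>t. flow t v g)"
  unfolding flow_def using someI_ex[OF solution_from_exists] by simp

lemma flow_0: "g \<in> C_space \<Longrightarrow> flow 0 v g = v"
  using solution_flow[of g v] by (simp add: solution_from_def)

text \<open>The solution restarted at time \<open>\<tau>\<close> solves the equation with translated
  forcing, and uniqueness identifies it with the flow.\<close>

lemma flow_add:
  assumes g: "g \<in> C_space" and t: "0 \<le> t" and \<tau>: "0 \<le> \<tau>"
  shows "flow (t + \<tau>) v g = flow t (flow \<tau> v g) (translate \<tau> g)"
proof -
  have deriv: "((\<lambda>s. flow (s + \<tau>) v g) has_vector_derivative
      (rhs (flow (s + \<tau>) v g) + g (s + \<tau>))) (at s within {0..})" if s: "0 \<le> s" for s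
  proof -
    have "((\<lambda>s. flow s v g) has_vector_derivative (rhs (flow (s + \<tau>) v g) + g (s + \<tau>)))
        (at (s + \<tau>) within {0..})"
      using solution_flow[OF g, of v] add_nonneg_nonneg[OF s \<tau>]
      unfolding solution_from_def rhs_def by blast
    \<comment> \<open>The chain rule asks for the derivative within the image of the half-line,
      which is a smaller half-line.\<close>
    moreover have "(\<lambda>s. s + \<tau>) ` {0..} \<subseteq> {0..}"
      using \<tau> by auto
    ultimately have "((\<lambda>s. flow s v g) has_vector_derivative (rhs (flow (s + \<tau>) v g) + g (s + \<tau>)))
        (at (s + \<tau>) within (\<lambda>s. s + \<tau>) ` {0..})"
      by (rule has_vector_derivative_within_subset)
    moreover have "((\<lambda>s. s + \<tau>) has_vector_derivative 1) (at s within {0..})"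
      by (auto intro!: derivative_eq_intros)
    ultimately have "((\<lambda>s. flow s v g) \<circ> (\<lambda>s. s + \<tau>) has_vector_derivative
        1 *\<^sub>R (rhs (flow (s + \<tau>) v g) + g (s + \<tau>))) (at s within {0..})"
      by (intro vector_diff_chain_within)
    then show ?thesis by (simp add: o_def)
  qed
  have "solution_from \<nu> lam F (translate \<tau> g) (flow \<tau> v g) (\<lambda>s. flow (s + \<tau>) v g)"
    unfolding solution_from_def translate_def
    by (intro conjI allI impI deriv[unfolded rhs_def]) simp_all
  from solution_from_unique[OF this solution_flow[OF translate_in_C_space[OF g]] t] show ?thesis .
qed

section \<open>Joint continuity of the flow in time, initial value and forcing\<close>

text \<open>First \<open>v\<close> and \<open>g\<close> are varied at the fixed time
  \<open>t\<close> by the difference estimate, then time is varied along the one solution with data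
  \<open>v0\<close> and \<open>g0\<close>.\<close>

lemma flow_continuous:
  assumes g0: "g0 \<in> C_space" and t0: "0 \<le> t0" and \<epsilon>: "0 < \<epsilon>"
  shows "\<exists>d>0. \<forall>t v g. 0 \<le> t \<longrightarrow> dist t t0 < d \<longrightarrow> dist v v0 < d \<longrightarrow> g \<in> C_space \<longrightarrow>
    C_metric g0 g < d \<longrightarrow> dist (flow t v g) (flow t0 v0 g0) < \<epsilon>"
proof -
  \<comment> \<open>With \<open>d \<le> 1\<close>, every time \<open>t\<close> considered stays in
    \<open>{0..T}\<close>.\<close>
  define T where "T = t0 + 1"
  have T: "0 < T" using t0 by (simp add: T_def)
  have "bounded (g0 ` {0..T})"
    using g0 by (intro compact_imp_bounded compact_continuous_image)
      (auto simp: C_space_def intro: continuous_on_subset)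
  then obtain G where G: "\<And>t. t \<in> {0..T} \<Longrightarrow> norm (g0 t) \<le> G"
    by (metis bounded_iff imageI)
  \<comment> \<open>The added ones leave room for all data at distance less than 1, so a single
    Lipschitz constant serves the whole neighbourhood.\<close>
  define R where "R = sqrt (exp T * ((norm v0 + 1)\<^sup>2 + (G + 1)\<^sup>2 * T))"
  obtain L where L: "L-lipschitz_on {- R..R} F" by (rule F_lipschitz_on_interval)
  \<comment> \<open>Data within \<open>d\<close> give a squared difference of at most
    \<open>C * d\<^sup>2\<close>.\<close>
  define C where "C = exp ((2 * L + 1) * T) * (1 + T)"
  have C: "0 < C" using T by (simp add: C_def)
  have bound: "norm (flow t v g) \<le> R"
    if g: "g \<in> C_space" and "norm v \<le> norm v0 + 1" and "\<forall>t\<in>{0..T}. norm (g t) \<le> G + 1"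
      and t: "t \<in> {0..T}" for t v g
  proof -
    have "norm (flow t v g) \<le> sqrt (exp T * ((norm v)\<^sup>2 + (G + 1)\<^sup>2 * T))"
      by (rule solution_on_bound[OF solution_from_imp_solution_on[OF solution_flow[OF g]] _ t]) (use that in auto)
    also have "\<dots> \<le> R"
      unfolding R_def using \<open>norm v \<le> norm v0 + 1\<close>
      by (intro real_sqrt_le_mono mult_left_mono add_right_mono power_mono) auto
    finally show ?thesis .
  qed
  have "continuous_on {0..} (\<lambda>t. flow t v0 g0)"
    using solution_flow[OF g0, of v0] unfolding solution_from_def
    by (auto intro: continuous_on_vector_derivative)
  then obtain d1 where d1: "0 < d1"
    "\<And>t. 0 \<le> t \<Longrightarrow> dist t t0 < d1 \<Longrightarrow> dist (flow t v0 g0) (flow t0 v0 g0) < \<epsilon> / 2"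
    using t0 \<epsilon> unfolding continuous_on_iff by (meson atLeast_iff half_gt_zero)
  \<comment> \<open>The bound \<open>1 / T\<close> makes \<open>C_metric\<close> control the forcing
    on all of \<open>{0..T}\<close>. The last entry gives
    \<open>sqrt C * d \<le> \<epsilon> / 3\<close>, which together with
    \<open>\<epsilon> / 2\<close> from the time variation stays below
    \<open>\<epsilon>\<close>.\<close>
  define d where "d = min (min 1 (1 / T)) (min d1 (\<epsilon> / (3 * sqrt C)))"
  have d: "0 < d" "d \<le> 1" "d \<le> 1 / T" "d \<le> d1" "d \<le> \<epsilon> / (3 * sqrt C)"
    unfolding d_def using T d1(1) \<epsilon> C by (simp_all add: min_le_iff_disj)
  show ?thesis
  proof (intro exI[of _ d] conjI allI impI)
    fix t v g
    assume t: "0 \<le> t" "dist t t0 < d" and v: "dist v v0 < d" and g: "g \<in> C_space" "C_metric g0 g < d"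
    have tT: "t \<in> {0..T}" using t d(2) by (auto simp: T_def dist_real_def)
    have near: "norm (g0 s - g s) < d" if "s \<in> {0..T}" for s
      using C_metric_less_imp_norm_less[OF g0 g d(3)] that T by auto
    have "norm (g s) \<le> G + 1" if "s \<in> {0..T}" for s
      using near[OF that] G[OF that] d(2) norm_triangle_ineq4[of "g0 s" "g0 s - g s"] by simp
    then have gG: "\<forall>s\<in>{0..T}. norm (g s) \<le> G + 1" by blast
    have "norm v \<le> norm v0 + 1"
      using v d(2) norm_triangle_sub[of v v0] by (simp add: dist_norm)
    note R = bound[OF g(1) this gG]
    have "\<forall>s\<in>{0..T}. norm (g0 s) \<le> G + 1" using G by fastforce
    note R0 = bound[OF g0 _ this, of v0, OF add_increasing2[OF zero_le_one order_refl]]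
    have "(norm (flow t v g - flow t v0 g0))\<^sup>2 \<le> exp ((2 * L + 1) * T) * ((norm (v - v0))\<^sup>2 + d\<^sup>2 * T)"
      by (rule solution_on_diff_bound[OF solution_from_imp_solution_on[OF solution_flow[OF g(1)]]
            solution_from_imp_solution_on[OF solution_flow[OF g0]] R R0 L _ tT])
        (use near in \<open>auto simp: norm_minus_commute less_imp_le\<close>)
    also have "\<dots> \<le> exp ((2 * L + 1) * T) * (d\<^sup>2 + d\<^sup>2 * T)"
      using v by (intro mult_left_mono add_right_mono power_mono) (auto simp: dist_norm)
    also have "\<dots> = (sqrt C * d)\<^sup>2"
      unfolding power_mult_distrib real_sqrt_pow2[OF less_imp_le[OF C]] by (simp add: C_def algebra_simps)
    finally have "norm (flow t v g - flow t v0 g0) \<le> sqrt C * d"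
      by (rule power2_le_imp_le) (use C d in simp)
    also have "\<dots> \<le> \<epsilon> / 3"
      using mult_left_mono[OF d(5), of "sqrt C"] C by simp
    finally have "dist (flow t v g) (flow t v0 g0) \<le> \<epsilon> / 3" by (simp add: dist_norm)
    moreover have "dist (flow t v0 g0) (flow t0 v0 g0) < \<epsilon> / 2"
      using d1(2) t d(4) by simp
    ultimately show "dist (flow t v g) (flow t0 v0 g0) < \<epsilon>"
      using dist_triangle[of "flow t v g" "flow t0 v0 g0" "flow t v0 g0"] \<epsilon> by linarith
  qed (rule d)
qed

text \<open>The target is metric, so it suffices to find an open box around each point that is
  mapped into a given ball; \<open>flow_continuous\<close> supplies its size.\<close>

lemma continuous_map_flow:
  assumes H: "H \<subseteq> C_space"
  shows "continuous_map
    (prod_topology (top_of_set {0..}) (prod_topology euclidean (subtopology C_topology H)))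
    euclidean (\<lambda>(t, v, g). flow t v g)"
proof -
  interpret C: Metric_space C_space "C_metric :: (real \<Rightarrow> ell2) \<Rightarrow> _" by (rule Metric_space_C)
  let ?X = "prod_topology (top_of_set {0..}) (prod_topology euclidean (subtopology C_topology H))"
  have "\<exists>U. openin ?X U \<and> x \<in> U \<and> (\<forall>y\<in>U. (\<lambda>(t, v, g). flow t v g) y \<in> ball ((\<lambda>(t, v, g). flow t v g) x) \<epsilon>)"
    if x: "x \<in> topspace ?X" and \<epsilon>: "0 < \<epsilon>" for x \<epsilon>
  proof -
    obtain t0 v0 g0 where x_eq: "x = (t0, v0, g0)" by (cases x)
    with x H have t0: "0 \<le> t0" and g0: "g0 \<in> C_space" "g0 \<in> H" by auto
    obtain d where d: "0 < d" "\<And>t v g. 0 \<le> t \<Longrightarrow> dist t t0 < d \<Longrightarrow> dist v v0 < d \<Longrightarrow> g \<in> C_space \<Longrightarrow>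
        C_metric g0 g < d \<Longrightarrow> dist (flow t v g) (flow t0 v0 g0) < \<epsilon>"
      using flow_continuous[OF g0(1) t0 \<epsilon>, of v0] by metis
    let ?U = "({0..} \<inter> ball t0 d) \<times> ball v0 d \<times> (H \<inter> C.mball g0 d)"
    have "openin (subtopology C_topology H) (H \<inter> C.mball g0 d)"
      unfolding C_topology_def by (simp add: openin_subtopology_Int2)
    then have "openin ?X ?U"
      by (auto simp: openin_prod_Times_iff openin_open_Int)
    moreover have "x \<in> ?U" using d(1) t0 g0 by (simp add: x_eq)
    moreover have "(\<lambda>(t, v, g). flow t v g) y \<in> ball ((\<lambda>(t, v, g). flow t v g) x) \<epsilon>" if "y \<in> ?U" for y
      using that d(2) by (auto simp: x_eq dist_commute)
    ultimately show ?thesis by blast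
  qed
  then show ?thesis
    using Met_TC.continuous_map_to_metric[of ?X "\<lambda>(t, v, g). flow t v g"] by simp
qed

end

theorem theorem2p11:
  fixes \<nu> lam \<alpha> :: real and f :: "real \<Rightarrow> ell2" and F :: "real \<Rightarrow> real"
  assumes "\<nu> > 0" and "lam > 0" and "\<alpha> > 0"
    and "f \<in> C_space" and "translation_compact f"
    and "continuous_on UNIV F" and "lipschitz_on_bounded_sets F" and "F 0 = 0"
    and "\<forall>s. s * F s \<le> - \<alpha> * s\<^sup>2"
  shows "\<exists>\<phi> :: real \<Rightarrow> ell2 \<Rightarrow> (real \<Rightarrow> ell2) \<Rightarrow> ell2.
    (\<forall>v. \<forall>g\<in>hull_of f.
       solution_from \<nu> lam F g v (\<lambda>t. \<phi> t v g) \<and>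
       (\<forall>u. solution_from \<nu> lam F g v u \<longrightarrow> (\<forall>t\<ge>0. u t = \<phi> t v g))) \<and>
    (\<forall>v. \<forall>g\<in>hull_of f. \<phi> 0 v g = v) \<and>
    (\<forall>t\<ge>0. \<forall>\<tau>\<ge>0. \<forall>v. \<forall>g\<in>hull_of f.
       \<phi> (t + \<tau>) v g = \<phi> t (\<phi> \<tau> v g) (translate \<tau> g)) \<and>
    continuous_map
      (prod_topology (top_of_set {0..}) (prod_topology euclidean (subtopology C_topology (hull_of f))))
      euclidean
      (\<lambda>(t, v, g). \<phi> t v g)"
proof -
  interpret lattice_ode \<nu> lam F
  proof
    show "s * F s \<le> 0" for s
    proof -
      have "- \<alpha> * s\<^sup>2 \<le> 0" using \<open>\<alpha> > 0\<close> by simp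
      with assms(9)[rule_format, of s] show ?thesis by (rule order_trans)
    qed
  qed (use assms in auto)
  \<comment> \<open>All members of the hull are continuous, so the results for forcings in
    \<open>C_space\<close> apply to them.\<close>
  have C: "g \<in> C_space" if "g \<in> hull_of f" for g using that hull_of_subset_C_space by blast
  show ?thesis
    by (intro exI[of _ flow] conjI allI impI ballI continuous_map_flow hull_of_subset_C_space
        solution_flow flow_0 flow_add solution_from_unique[OF _ solution_flow] C)
qed

end
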